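(* Let $N\ge1$, $P=2N$, and let $x_1,\dots,x_N\in\mathbb{R}$ be pairwise distinct. There is a constant $C_1$ depending only on $x_1,\dots,x_N$ such that the following holds. Let $a_1,\dots,a_N\in\mathbb{R}$ with $a_j\ne0$ for all $j=1,\dots,N$, and let $$m_k=\sum_{j=1}^N a_jx_j^k,\qquad k=0,1,\dots,P-1,$$ be the exact moments. Then for all sufficiently small $\varepsilon>0$ (that is, for all $0<\varepsilon<\varepsilon_0$, where $\varepsilon_0>0$ may depend on all $a_j$ and $x_j$) and for all real perturbed moments $\widetilde m_0,\dots,\widetilde m_{P-1}$ with $\max_{0\le k\le P-1}|m_k-\widetilde m_k|<\varepsilon$, the perturbed Prony system $$\sum_{j=1}^N \widetilde a_j\,\widetilde x_j^{\,k}=\widetilde m_k,\qquad k=0,1,\dots,P-1,$$ has a solution $(\widetilde a_j,\widetilde x_j)_{j=1}^N$ in real numbers, unique up to permutation of the index $j$, and, with suitable numbering, this solution satisfies for every $j=1,\dots,N$ $$|\widetilde x_j-x_j|\le C_1\,\varepsilon\,|a_j|^{-1},\qquad |\widetilde a_j-a_j|\le C_1\,\varepsilon .$$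
   Context: The numbers $m_k$ are the moments $\int x^k$ of the distribution $\sum_{j=1}^N a_j\delta(x-x_j)$. The convention $0^0=1$ is used. *)

theory Defs
  imports Complex_Main "HOL-Combinatorics.Permutations"
begin

definition moment :: "nat \<Rightarrow> (nat \<Rightarrow> real) \<Rightarrow> (nat \<Rightarrow> real) \<Rightarrow> nat \<Rightarrow> real" where
  "moment N a x k = (\<Sum>j=1..N. a j * x j ^ k)"

text \<open>
  Only the values \<open>a j\<close>, \<open>x j\<close> for \<open>1 \<le> j \<le> N\<close> and \<open>\<mu> k\<close> for \<open>k < 2 * N\<close> matter.
  A solution is an arbitrary real tuple: neither nonzero amplitudes nor distinct nodes are required.
\<close>

definition prony_solution ::
    "nat \<Rightarrow> (nat \<Rightarrow> real) \<Rightarrow> (nat \<Rightarrow> real) \<Rightarrow> (nat \<Rightarrow> real) \<Rightarrow> bool" where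
  "prony_solution N \<mu> a x \<longleftrightarrow> (\<forall>k<2 * N. moment N a x k = \<mu> k)"

end

theory Submission
  imports Defs "HOL-Computational_Algebra.Polynomial"
begin

text \<open>
  A tuple \<open>(a, x)\<close> solves the Prony system for moments \<open>\<mu>\<close> exactly when the linear functional
  \<open>L\<close> with \<open>L(t\<^sup>k) = \<mu> k\<close> for \<open>k < 2N\<close> is given on polynomials of degree below \<open>2N\<close> by the quadrature formula
  \<open>L(p) = \<Sum> a\<^sub>j p(x\<^sub>j)\<close> (\<open>prony_solution_iff_quadrature\<close>). This turns the nonlinear system into
  Gauss quadrature: the node polynomial \<open>Q = \<Prod> (t - y\<^sub>j)\<close> of a solution is \<open>L\<close>-orthogonal to all
  polynomials of degree below \<open>N\<close>, and conversely every real simple-rooted \<open>Q\<close> of degree \<open>N\<close>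
  with this orthogonality yields a solution (\<open>prony_solution_of_orthogonal_node_poly\<close>).
  
  For existence and the bound on the nodes, write \<open>Q = P + \<Sum> c\<^sub>j \<ell>\<^sub>j\<close>, where \<open>P\<close> is the node polynomial of
  \<open>x\<close> and \<open>\<ell>\<^sub>j\<close> its Lagrange basis. For the exact moments the Gram matrix \<open>L(\<ell>\<^sub>i \<ell>\<^sub>j)\<close> is diagonal with
  entries \<open>a\<^sub>i\<close>, and \<open>L(P \<ell>\<^sub>i) = 0\<close>. For the perturbed moments both hold up to \<open>O(\<epsilon>)\<close>, with a constant
  that depends on the nodes only; so orthogonality is a nearly diagonal linear system for \<open>c\<close>, and its
  \<open>i\<close>-th row gives \<open>a\<^sub>i c\<^sub>i = O(\<epsilon>)\<close> (\<open>orthogonal_poly_exists\<close>). It is the row-by-row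
  form of this bound that makes the node error proportional to \<open>1 / \<bar>a\<^sub>i\<bar>\<close> with the same \<open>i\<close>: near \<open>x\<^sub>i\<close> the
  polynomial \<open>Q\<close> is essentially \<open>P'(x\<^sub>i) (t - x\<^sub>i) + c\<^sub>i\<close>, since the other \<open>\<ell>\<^sub>j\<close> vanish at \<open>x\<^sub>i\<close>, and the
  intermediate value theorem finds a root at distance \<open>O(\<bar>c\<^sub>i\<bar>)\<close> (\<open>perturbed_node_poly_root\<close>).
  
  The bound on the amplitudes must avoid the factor \<open>1 / \<bar>a\<^sub>i\<bar>\<close>. For this, test the functional with the Hermite
  polynomial \<open>h\<^sub>i\<close>, which has the values of \<open>\<ell>\<^sub>i\<close> and vanishing derivative at all nodes. Node errors then
  enter \<open>L(h\<^sub>i)\<close> only quadratically, and for small \<open>\<epsilon>\<close> this is negligible against the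
  error \<open>O(\<epsilon>)\<close> of \<open>L(h\<^sub>i)\<close> itself (\<open>amplitude_perturbation\<close>).
  
  For uniqueness, let \<open>(a, x)\<close> and \<open>(b, y)\<close> solve the same system, the first with distinct nodes and
  nonzero amplitudes. Testing with \<open>\<Prod> (t - y\<^sub>k) \<ell>\<^sub>j\<close> kills the \<open>b\<close> side and leaves
  \<open>a\<^sub>j \<Prod> (x\<^sub>j - y\<^sub>k) = 0\<close>. So every \<open>x\<^sub>j\<close> is among the \<open>N\<close> numbers \<open>y\<^sub>k\<close>, which are therefore a
  permutation of the \<open>x\<^sub>j\<close> (\<open>prony_solution_unique\<close>).
\<close>

section \<open>Polynomials with prescribed nodes\<close>

definition node_poly :: "'i set \<Rightarrow> ('i \<Rightarrow> real) \<Rightarrow> real poly" where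
  "node_poly S x = (\<Prod>j\<in>S. [:- x j, 1:])"

text \<open>
  This is the derivative of the node polynomial at the node \<open>x i\<close>, written as a product.
\<close>

definition node_weight :: "'i set \<Rightarrow> ('i \<Rightarrow> real) \<Rightarrow> 'i \<Rightarrow> real" where
  "node_weight S x i = poly (node_poly (S - {i}) x) (x i)"

definition lagrange_poly :: "'i set \<Rightarrow> ('i \<Rightarrow> real) \<Rightarrow> 'i \<Rightarrow> real poly" where
  "lagrange_poly S x i = smult (inverse (node_weight S x i)) (node_poly (S - {i}) x)"

text \<open>
  The linear factor is chosen so that its slope at \<open>x i\<close> cancels the derivative of the squared Lagrange
  polynomial there; at every other node the square already has a double root.
\<close>

definition hermite_poly :: "'i set \<Rightarrow> ('i \<Rightarrow> real) \<Rightarrow> 'i \<Rightarrow> real poly" where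
  "hermite_poly S x i =
    (lagrange_poly S x i)\<^sup>2 * (1 - smult (2 * poly (pderiv (lagrange_poly S x i)) (x i)) [:- x i, 1:])"

lemma poly_node_poly: "poly (node_poly S x) t = (\<Prod>j\<in>S. t - x j)"
  by (simp add: node_poly_def poly_prod)

lemma degree_node_poly: "degree (node_poly S x) = card S"
  unfolding node_poly_def by (subst degree_prod_eq_sum_degree) auto

lemma lead_coeff_node_poly: "lead_coeff (node_poly S x) = 1"
  unfolding node_poly_def by (subst lead_coeff_prod) auto

lemma node_poly_nonzero: "node_poly S x \<noteq> 0"
  using lead_coeff_node_poly[of S x] by auto

lemma node_weight_nonzero:
  assumes "finite S" "inj_on x S" "i \<in> S"
  shows "node_weight S x i \<noteq> 0"
  using assms by (auto simp: node_weight_def poly_node_poly inj_on_def)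

lemma node_poly_eq_lagrange:
  assumes "finite S" "inj_on x S" "i \<in> S"
  shows "poly (node_poly S x) t = (t - x i) * node_weight S x i * poly (lagrange_poly S x i) t"
  using assms node_weight_nonzero[OF assms]
  by (simp add: lagrange_poly_def poly_node_poly prod.remove)

lemma poly_lagrange_poly:
  assumes "finite S" "inj_on x S" "i \<in> S" "j \<in> S"
  shows "poly (lagrange_poly S x i) (x j) = of_bool (i = j)"
proof (cases "i = j")
  case True
  then show ?thesis using node_weight_nonzero[OF assms(1-3)]
    by (simp add: lagrange_poly_def node_weight_def)
next
  case False
  then show ?thesis using assms by (auto simp: lagrange_poly_def poly_node_poly)
qed

lemma degree_lagrange_poly:
  assumes "finite S" "i \<in> S"
  shows "degree (lagrange_poly S x i) < card S"
proof -
  have "degree (lagrange_poly S x i) \<le> card (S - {i})"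
    using degree_smult_le[of "inverse (node_weight S x i)" "node_poly (S - {i}) x"]
    by (simp add: lagrange_poly_def degree_node_poly)
  also have "\<dots> < card S" using assms by (rule card_Diff1_less)
  finally show ?thesis .
qed

lemma degree_hermite_poly:
  assumes "finite S" "i \<in> S"
  shows "degree (hermite_poly S x i) < 2 * card S"
proof -
  let ?l = "lagrange_poly S x i"
  have l: "degree ?l < card S" using degree_lagrange_poly[OF assms] .
  have "degree (1 - smult (2 * poly (pderiv ?l) (x i)) [:- x i, 1:]) \<le> 1"
    by (intro degree_diff_le) (auto intro: order.trans[OF degree_smult_le])
  moreover have "degree (?l\<^sup>2) \<le> 2 * degree ?l"
    using degree_power_le[of ?l 2] by (simp add: mult.commute)
  ultimately have "degree (hermite_poly S x i) \<le> 2 * degree ?l + 1"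
    unfolding hermite_poly_def by (meson add_mono degree_mult_le order_trans)
  then show ?thesis using l by linarith
qed

lemma square_dvd_hermite_poly:
  assumes "finite S" "inj_on x S" "i \<in> S" "j \<in> S"
  shows "[:- x j, 1:]\<^sup>2 dvd hermite_poly S x i - [:of_bool (i = j):]"
proof -
  let ?l = "lagrange_poly S x i" and ?p = "hermite_poly S x i - [:of_bool (i = j):]"
  have v: "poly ?p (x j) = 0"
    using poly_lagrange_poly[OF assms] by (simp add: hermite_poly_def)
  have d: "poly (pderiv ?p) (x j) = 0"
    using poly_lagrange_poly[OF assms]
    by (cases "i = j")
      (simp_all add: hermite_poly_def pderiv_mult pderiv_diff pderiv_smult pderiv_pCons
        power2_eq_square pderiv_1)
  obtain q where q: "?p = [:- x j, 1:] * q" using v by (metis dvdE poly_eq_0_iff_dvd)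
  have "poly q (x j) = 0" using d unfolding q by (simp add: pderiv_mult pderiv_pCons del: mult_pCons_left)
  then obtain r where "q = [:- x j, 1:] * r" by (metis dvdE poly_eq_0_iff_dvd)
  then show ?thesis unfolding q by (metis dvd_triv_left mult.assoc power2_eq_square)
qed

lemma poly_zero_of_many_roots:
  fixes p :: "real poly"
  assumes "inj_on x S" "degree p < card S" "\<And>i. i \<in> S \<Longrightarrow> poly p (x i) = 0"
  shows "p = 0"
proof (rule ccontr)
  assume p: "p \<noteq> 0"
  have "card S = card (x ` S)" using assms(1) by (simp add: card_image)
  also have "\<dots> \<le> card {t. poly p t = 0}"
    using assms(3) by (intro card_mono poly_roots_finite[OF p]) auto
  also have "\<dots> \<le> degree p" using p by (rule card_poly_roots_bound)
  finally show False using assms(2) by simp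
qed

text \<open>
  Both sides have degree below the number of nodes and agree at the nodes.
\<close>

lemma lagrange_interpolation:
  assumes "finite S" "inj_on x S" "degree p < card S"
  shows "p = (\<Sum>i\<in>S. smult (poly p (x i)) (lagrange_poly S x i))"
proof -
  let ?q = "\<Sum>i\<in>S. smult (poly p (x i)) (lagrange_poly S x i)"
  have "degree ?q \<le> card S - 1"
    using degree_lagrange_poly[OF assms(1), of _ x]
    by (intro degree_sum_le assms(1)) (fastforce intro: order.trans[OF degree_smult_le])
  moreover have "poly (p - ?q) (x j) = 0" if "j \<in> S" for j
    using that assms by (simp add: poly_sum poly_lagrange_poly if_distrib of_bool_def cong: if_cong)
  ultimately have "p - ?q = 0"
    using assms(3) by (intro poly_zero_of_many_roots[OF assms(2)] degree_diff_less) auto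
  then show ?thesis by simp
qed

text \<open>
  Stating the estimate for all large \<open>D\<close> instead of some \<open>D\<close> lets finitely many such estimates share
  one constant by filter arithmetic. The quotient of \<open>p\<close> by the power is bounded on the compact
  interval of radius \<open>1\<close> around \<open>x0\<close>.
\<close>

lemma eventually_power_bound_near_root:
  fixes p :: "real poly"
  assumes "[:- x0, 1:] ^ n dvd p"
  shows "\<forall>\<^sub>F D in at_top. \<forall>t. \<bar>t - x0\<bar> \<le> 1 \<longrightarrow> \<bar>poly p t\<bar> \<le> D * \<bar>t - x0\<bar> ^ n"
proof -
  obtain q where q: "p = [:- x0, 1:] ^ n * q" using assms by (elim dvdE)
  have "\<exists>M. \<forall>t. x0 - 1 \<le> t \<and> t \<le> x0 + 1 \<longrightarrow> \<bar>poly q t\<bar> \<le> M"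
    by (rule isCont_bounded) auto
  then obtain M where "\<forall>t. x0 - 1 \<le> t \<and> t \<le> x0 + 1 \<longrightarrow> \<bar>poly q t\<bar> \<le> M" by blast
  then have M: "\<bar>poly q t\<bar> \<le> M" if "\<bar>t - x0\<bar> \<le> 1" for t
    using that by (auto simp: abs_le_iff)
  show ?thesis
    using eventually_ge_at_top[of M]
  proof eventually_elim
    case (elim D)
    have "\<bar>poly p t\<bar> \<le> D * \<bar>t - x0\<bar> ^ n" if "\<bar>t - x0\<bar> \<le> 1" for t
    proof -
      have "\<bar>poly p t\<bar> = \<bar>poly q t\<bar> * \<bar>t - x0\<bar> ^ n"
        by (simp add: q abs_mult poly_power power_abs algebra_simps)
      also have "\<dots> \<le> D * \<bar>t - x0\<bar> ^ n"
        using M[OF that] elim by (intro mult_right_mono) auto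
      finally show ?thesis .
    qed
    then show ?case by blast
  qed
qed

section \<open>Nearly diagonal linear systems\<close>

text \<open>
  Gaussian elimination: an equation with a nonzero coefficient at \<open>j0\<close> eliminates the unknown \<open>j0\<close>
  from the others, which leaves one equation and one unknown less.
\<close>

lemma underdetermined_system_nontrivial_solution:
  fixes A :: "'i \<Rightarrow> 'j \<Rightarrow> real"
  assumes "finite S" "finite T" "card S < card T"
  shows "\<exists>c. (\<exists>j\<in>T. c j \<noteq> 0) \<and> (\<forall>i\<in>S. (\<Sum>j\<in>T. A i j * c j) = 0)"
  using assms
proof (induction S arbitrary: T A rule: finite_induct)
  case empty
  then have "T \<noteq> {}" by auto
  then show ?case by (intro exI[of _ "\<lambda>_. 1"]) auto
next
  case (insert s S)
  show ?case
  proof (cases "\<forall>j\<in>T. A s j = 0")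
    case True
    from insert.IH[of T A] insert.prems insert.hyps
    obtain c where "\<exists>j\<in>T. c j \<noteq> 0" "\<forall>i\<in>S. (\<Sum>j\<in>T. A i j * c j) = 0" by auto
    with True show ?thesis by (intro exI[of _ c]) auto
  next
    case False
    then obtain j0 where j0: "j0 \<in> T" "A s j0 \<noteq> 0" by blast
    let ?T = "T - {j0}" and ?A = "\<lambda>i j. A i j - A i j0 * A s j / A s j0"
    have "card S < card ?T" using insert.prems insert.hyps j0 by auto
    from insert.IH[OF _ this, of ?A] insert.prems
    obtain c where c: "\<exists>j\<in>?T. c j \<noteq> 0" "\<And>i. i \<in> S \<Longrightarrow> (\<Sum>j\<in>?T. ?A i j * c j) = 0" by auto
    let ?c = "c(j0 := - (\<Sum>j\<in>?T. A s j * c j) / A s j0)"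
    have split: "(\<Sum>j\<in>T. A i j * ?c j) = (\<Sum>j\<in>?T. ?A i j * c j)" for i
    proof -
      have "(\<Sum>j\<in>T. A i j * ?c j)
          = A i j0 * (- (\<Sum>j\<in>?T. A s j * c j) / A s j0) + (\<Sum>j\<in>?T. A i j * c j)"
        using insert.prems(1) j0(1) by (simp add: sum.remove)
      also have "\<dots> = (\<Sum>j\<in>?T. ?A i j * c j)"
        by (simp add: sum_subtractf sum_distrib_left sum_divide_distrib algebra_simps)
      finally show ?thesis .
    qed
    have "(\<Sum>j\<in>T. A s j * ?c j) = 0" unfolding split using j0 by simp
    with c split show ?thesis
      by (intro exI[of _ ?c]) auto
  qed
qed

text \<open>
  The right-hand side becomes an additional column, indexed by \<open>None\<close>. The enlarged homogeneous
  system has a nontrivial solution, and by injectivity its \<open>None\<close> entry is nonzero, so that dividing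
  by it solves the original system.
\<close>

lemma injective_square_system_solvable:
  fixes A :: "'i \<Rightarrow> 'i \<Rightarrow> real"
  assumes "finite S"
    and inj: "\<And>c. (\<And>i. i \<in> S \<Longrightarrow> (\<Sum>j\<in>S. A i j * c j) = 0) \<Longrightarrow> \<forall>j\<in>S. c j = 0"
  shows "\<exists>c. \<forall>i\<in>S. (\<Sum>j\<in>S. A i j * c j) = b i"
proof -
  let ?T = "insert None (Some ` S)" and ?A = "\<lambda>i. case_option (- b i) (A i)"
  have sumT: "(\<Sum>j\<in>?T. ?A i j * c j) = (\<Sum>j\<in>S. A i j * c (Some j)) - b i * c None" for i c
    using assms(1) by (simp add: sum.reindex)
  have "card S < card ?T" using assms(1) by (simp add: card_image)
  from underdetermined_system_nontrivial_solution[OF assms(1) _ this, of ?A]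
  obtain c where c: "\<exists>j\<in>?T. c j \<noteq> 0"
    and eq: "\<And>i. i \<in> S \<Longrightarrow> (\<Sum>j\<in>S. A i j * c (Some j)) = b i * c None"
    using assms(1) unfolding sumT by auto
  have "c None \<noteq> 0"
  proof
    assume "c None = 0"
    then show False using inj[of "c \<circ> Some"] eq c by auto
  qed
  then show ?thesis
    using eq by (intro exI[of _ "\<lambda>j. c (Some j) / c None"])
      (simp flip: sum_divide_distrib)
qed

text \<open>
  The largest \<open>\<bar>c j\<bar>\<close> is first bounded crudely through the common lower bound of the diagonal; fed back into the
  individual rows, this controls each \<open>a i * c i\<close> by the right-hand side alone, with no
  factor that depends on how different the diagonal entries are.
\<close>

lemma nearly_diagonal_system_bound:
  fixes E :: "'i \<Rightarrow> 'i \<Rightarrow> real"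
  assumes S: "finite S" and "\<alpha> > 0" and a: "\<And>i. i \<in> S \<Longrightarrow> \<alpha> \<le> \<bar>a i\<bar>"
    and E: "\<And>i j. i \<in> S \<Longrightarrow> j \<in> S \<Longrightarrow> \<bar>E i j\<bar> \<le> \<theta>"
    and small: "2 * real (card S) * \<theta> \<le> \<alpha>"
    and eq: "\<And>i. i \<in> S \<Longrightarrow> a i * c i + (\<Sum>j\<in>S. E i j * c j) = e i"
    and e: "\<And>i. i \<in> S \<Longrightarrow> \<bar>e i\<bar> \<le> \<eta>"
    and i: "i \<in> S"
  shows "\<bar>a i * c i\<bar> \<le> 2 * \<eta>"
proof -
  define M where "M = Max ((\<lambda>j. \<bar>c j\<bar>) ` S)"
  have cM: "\<bar>c j\<bar> \<le> M" if "j \<in> S" for j using S that by (auto simp: M_def)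
  have M0: "M \<ge> 0" using cM[OF i] by linarith
  have row: "\<bar>a k * c k\<bar> \<le> \<eta> + \<alpha> * M / 2" if k: "k \<in> S" for k
  proof -
    have "\<bar>\<Sum>j\<in>S. E k j * c j\<bar> \<le> (\<Sum>j\<in>S. \<theta> * M)"
      using E[OF k] cM by (intro order.trans[OF sum_abs] sum_mono) (auto simp: abs_mult intro!: mult_mono')
    also have "\<dots> = (real (card S) * \<theta>) * M" by simp
    also have "\<dots> \<le> (\<alpha> / 2) * M" using small M0 by (intro mult_right_mono) auto
    finally show ?thesis using eq[OF k] e[OF k] by (simp add: abs_le_iff) linarith
  qed
  have "M \<in> (\<lambda>j. \<bar>c j\<bar>) ` S" unfolding M_def using S i by (intro Max_in) auto
  then obtain k where k: "k \<in> S" "M = \<bar>c k\<bar>" by auto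
  have "\<alpha> * M \<le> \<bar>a k * c k\<bar>" using a[OF k(1)] M0 by (simp add: k(2) abs_mult mult_right_mono)
  with row[OF k(1)] have "\<alpha> * M \<le> 2 * \<eta>" by simp
  with row[OF i] show ?thesis by simp
qed

lemma nearly_diagonal_system_solvable:
  fixes E :: "'i \<Rightarrow> 'i \<Rightarrow> real"
  assumes S: "finite S" and \<alpha>: "\<alpha> > 0" and a: "\<And>i. i \<in> S \<Longrightarrow> \<alpha> \<le> \<bar>a i\<bar>"
    and E: "\<And>i j. i \<in> S \<Longrightarrow> j \<in> S \<Longrightarrow> \<bar>E i j\<bar> \<le> \<theta>"
    and small: "2 * real (card S) * \<theta> \<le> \<alpha>"
  shows "\<exists>c. \<forall>i\<in>S. a i * c i + (\<Sum>j\<in>S. E i j * c j) = e i"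
proof -
  let ?A = "\<lambda>i j. of_bool (i = j) * a i + E i j"
  have A: "(\<Sum>j\<in>S. ?A i j * c j) = a i * c i + (\<Sum>j\<in>S. E i j * c j)" if "i \<in> S" for i c
    using S that by (simp add: distrib_right sum.distrib of_bool_def if_distrib[of "\<lambda>u. u * _"] cong: if_cong)
  have "\<exists>c. \<forall>i\<in>S. (\<Sum>j\<in>S. ?A i j * c j) = e i"
  proof (rule injective_square_system_solvable[OF S])
    fix c assume hom: "\<And>i. i \<in> S \<Longrightarrow> (\<Sum>j\<in>S. ?A i j * c j) = 0"
    show "\<forall>j\<in>S. c j = 0"
    proof
      fix j assume j: "j \<in> S"
      have "\<bar>a j * c j\<bar> \<le> 2 * 0"
        by (rule nearly_diagonal_system_bound[where e = "\<lambda>_. 0" and E = E and c = c, OF S \<alpha> a E small _ _ j])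
          (use hom A in auto)
      then show "c j = 0" using a[OF j] \<alpha> by auto
    qed
  qed
  then show ?thesis using A by auto
qed

section \<open>Prony systems as quadrature formulas\<close>

definition moment_functional :: "nat \<Rightarrow> (nat \<Rightarrow> real) \<Rightarrow> real poly \<Rightarrow> real" where
  "moment_functional N \<mu> p = (\<Sum>k<2 * N. coeff p k * \<mu> k)"

lemma moment_functional_add:
  "moment_functional N \<mu> (p + q) = moment_functional N \<mu> p + moment_functional N \<mu> q"
  by (simp add: moment_functional_def distrib_right sum.distrib)

lemma moment_functional_smult:
  "moment_functional N \<mu> (smult c p) = c * moment_functional N \<mu> p"
  by (simp add: moment_functional_def sum_distrib_left mult.assoc)

lemma moment_functional_sum:
  "moment_functional N \<mu> (\<Sum>i\<in>S. f i) = (\<Sum>i\<in>S. moment_functional N \<mu> (f i))"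
proof (cases "finite S")
  case True
  then show ?thesis
    by (induction S rule: finite_induct) (simp_all add: moment_functional_add, simp add: moment_functional_def)
qed (simp add: moment_functional_def)

lemma moment_functional_monom:
  "k < 2 * N \<Longrightarrow> moment_functional N \<mu> (monom 1 k) = \<mu> k"
  by (simp add: moment_functional_def if_distrib[of "\<lambda>u. u * _"] cong: if_cong)

lemma prony_solution_iff_quadrature:
  "prony_solution N \<mu> a x \<longleftrightarrow>
    (\<forall>p. degree p < 2 * N \<longrightarrow> moment_functional N \<mu> p = (\<Sum>j=1..N. a j * poly p (x j)))"
proof
  assume sol: "prony_solution N \<mu> a x"
  show "\<forall>p. degree p < 2 * N \<longrightarrow> moment_functional N \<mu> p = (\<Sum>j=1..N. a j * poly p (x j))"
  proof (intro allI impI)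
    fix p :: "real poly" assume p: "degree p < 2 * N"
    have "poly p t = (\<Sum>k<2 * N. coeff p k * t ^ k)" for t
      unfolding poly_altdef using p by (intro sum.mono_neutral_left) (auto simp: coeff_eq_0)
    then have "(\<Sum>j=1..N. a j * poly p (x j)) = (\<Sum>j=1..N. \<Sum>k<2 * N. coeff p k * (a j * x j ^ k))"
      by (simp add: sum_distrib_left algebra_simps)
    also have "\<dots> = (\<Sum>k<2 * N. coeff p k * moment N a x k)"
      by (subst sum.swap) (simp add: moment_def sum_distrib_left)
    also have "\<dots> = moment_functional N \<mu> p"
      using sol by (simp add: moment_functional_def prony_solution_def)
    finally show "moment_functional N \<mu> p = (\<Sum>j=1..N. a j * poly p (x j))" by simp
  qed
next
  assume quad: "\<forall>p. degree p < 2 * N \<longrightarrow> moment_functional N \<mu> p = (\<Sum>j=1..N. a j * poly p (x j))"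
  have "moment N a x k = \<mu> k" if "k < 2 * N" for k
    using quad[rule_format, of "monom 1 k"] moment_functional_monom[OF that, of \<mu>] that
    by (simp add: moment_def poly_monom degree_monom_eq)
  then show "prony_solution N \<mu> a x" by (simp add: prony_solution_def)
qed

lemma prony_solution_moments: "prony_solution N (moment N a x) a x"
  by (simp add: prony_solution_def)

lemma moment_functional_perturbation:
  assumes "\<And>k. k < 2 * N \<Longrightarrow> \<bar>m k - \<mu> k\<bar> \<le> \<epsilon>" "(\<Sum>k<2 * N. \<bar>coeff p k\<bar>) \<le> D" "\<epsilon> \<ge> 0"
  shows "\<bar>moment_functional N \<mu> p - moment_functional N m p\<bar> \<le> D * \<epsilon>"
proof -
  have "\<bar>moment_functional N \<mu> p - moment_functional N m p\<bar> = \<bar>\<Sum>k<2 * N. coeff p k * (\<mu> k - m k)\<bar>"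
    by (simp add: moment_functional_def sum_subtractf right_diff_distrib)
  also have "\<dots> \<le> (\<Sum>k<2 * N. \<bar>coeff p k\<bar> * \<epsilon>)"
    using assms(1) by (intro order.trans[OF sum_abs] sum_mono)
      (auto simp: abs_mult abs_minus_commute intro!: mult_left_mono)
  also have "\<dots> \<le> D * \<epsilon>" using assms(2,3) by (simp add: mult_right_mono flip: sum_distrib_right)
  finally show ?thesis .
qed

text \<open>
  The argument of Gauss quadrature: divide \<open>p\<close> by the node polynomial. The quotient has degree
  below \<open>N\<close> and contributes nothing by orthogonality; the remainder is integrated exactly by
  interpolation and has the same node values as \<open>p\<close>.
\<close>

lemma prony_solution_of_orthogonal_node_poly:
  assumes N: "N \<ge> 1" and inj: "inj_on y {1..N}"
    and orth: "\<And>q. degree q < N \<Longrightarrow> moment_functional N \<mu> (node_poly {1..N} y * q) = 0"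
  shows "prony_solution N \<mu> (\<lambda>i. moment_functional N \<mu> (lagrange_poly {1..N} y i)) y"
  unfolding prony_solution_iff_quadrature
proof (intro allI impI)
  fix p :: "real poly" assume p: "degree p < 2 * N"
  let ?Q = "node_poly {1..N} y"
  define q where "q = p div ?Q"
  define r where "r = p mod ?Q"
  have Q: "degree ?Q = N" "?Q \<noteq> 0" by (simp_all add: degree_node_poly node_poly_nonzero)
  have pqr: "p = ?Q * q + r" by (simp add: q_def r_def)
  have r: "degree r < N" using degree_mod_less[OF Q(2), of p] Q N by (auto simp: r_def)
  have q: "degree q < N"
  proof (cases "q = 0")
    case False
    have "?Q * q = p - r" using pqr by simp
    then have "degree (?Q * q) < 2 * N" using p r by (simp add: degree_diff_less)
    then show ?thesis using False Q by (simp add: degree_mult_eq)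
  qed (use N in simp)
  have "poly ?Q (y j) = 0" if "j \<in> {1..N}" for j
    using that by (auto simp: poly_node_poly)
  then have pr: "poly p (y j) = poly r (y j)" if "j \<in> {1..N}" for j using that by (simp add: pqr)
  have "moment_functional N \<mu> p = moment_functional N \<mu> r"
    using orth[OF q] by (simp add: pqr moment_functional_add)
  also have "\<dots> = moment_functional N \<mu> (\<Sum>i=1..N. smult (poly r (y i)) (lagrange_poly {1..N} y i))"
    using lagrange_interpolation[OF _ inj, of r] r by simp
  also have "\<dots> = (\<Sum>j=1..N. moment_functional N \<mu> (lagrange_poly {1..N} y j) * poly p (y j))"
    by (simp add: moment_functional_sum moment_functional_smult pr mult.commute)
  finally show "moment_functional N \<mu> p
      = (\<Sum>j=1..N. moment_functional N \<mu> (lagrange_poly {1..N} y j) * poly p (y j))" .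
qed

text \<open>
  The competitor \<open>(b, y)\<close> is an arbitrary real tuple. Its node polynomial, multiplied by a Lagrange
  polynomial of \<open>x\<close>, still has degree below \<open>2 * N\<close>; as it vanishes at every \<open>y k\<close>, it shows that each
  \<open>x j\<close> occurs among the \<open>y k\<close>. Counting forces \<open>y\<close> to be a rearrangement of \<open>x\<close>, and the Lagrange
  polynomials themselves then read off the amplitudes.
\<close>

lemma prony_solution_unique:
  assumes sol: "prony_solution N \<mu> a x" and inj: "inj_on x {1..N}"
    and nz: "\<And>j. j \<in> {1..N} \<Longrightarrow> a j \<noteq> 0"
    and sol': "prony_solution N \<mu> b y"
  shows "\<exists>\<pi>. \<pi> permutes {1..N} \<and> (\<forall>j\<in>{1..N}. b j = a (\<pi> j) \<and> y j = x (\<pi> j))"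
proof -
  let ?S = "{1..N}" and ?l = "lagrange_poly {1..N} x"
  have eval: "(\<Sum>k\<in>?S. a k * poly (p * ?l j) (x k)) = a j * poly p (x j)" if "j \<in> ?S" for p j
  proof -
    have "(\<Sum>k\<in>?S. a k * poly (p * ?l j) (x k)) = (\<Sum>k\<in>?S. if j = k then a k * poly p (x k) else 0)"
      using that inj by (intro sum.cong) (auto simp: poly_lagrange_poly)
    then show ?thesis using that by simp
  qed
  have "poly (node_poly ?S y) (x j) = 0" if j: "j \<in> ?S" for j
  proof -
    have d: "degree (node_poly ?S y * ?l j) < 2 * N"
      using degree_lagrange_poly[of ?S j x] j degree_mult_le[of "node_poly ?S y" "?l j"]
      by (simp add: degree_node_poly)
    have "a j * poly (node_poly ?S y) (x j) = (\<Sum>k\<in>?S. b k * poly (node_poly ?S y * ?l j) (y k))"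
      using sol[unfolded prony_solution_iff_quadrature, rule_format, OF d]
        sol'[unfolded prony_solution_iff_quadrature, rule_format, OF d] eval[OF j]
      by metis
    also have "\<dots> = 0" by (intro sum.neutral) (auto simp: poly_node_poly)
    finally show ?thesis using nz[OF j] by simp
  qed
  then have sub: "x ` ?S \<subseteq> y ` ?S" by (fastforce simp: poly_node_poly)
  have cardx: "card (x ` ?S) = N" using inj by (simp add: card_image)
  have im: "x ` ?S = y ` ?S"
    using sub cardx card_image_le[of ?S y] by (intro card_subset_eq) (auto intro: antisym card_mono dest: card_mono[rotated])
  have injy: "inj_on y ?S" using cardx im by (intro eq_card_imp_inj_on) auto
  define \<pi> where "\<pi> j = (if j \<in> ?S then inv_into ?S x (y j) else j)" for j
  have \<pi>: "\<pi> j \<in> ?S" "x (\<pi> j) = y j" if "j \<in> ?S" for j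
    using that im by (auto simp: \<pi>_def f_inv_into_f inv_into_into simp del: atLeastAtMost_iff)
  have "inj_on \<pi> ?S" using \<pi>(2) injy by (metis inj_on_def)
  moreover have "\<pi> ` ?S \<subseteq> ?S" using \<pi>(1) by blast
  ultimately have "bij_betw \<pi> ?S ?S" by (simp add: bij_betw_def endo_inj_surj)
  then have perm: "\<pi> permutes ?S" by (intro bij_imp_permutes) (auto simp: \<pi>_def)
  have "b j = a (\<pi> j)" if j: "j \<in> ?S" for j
  proof -
    have d: "degree (1 * ?l (\<pi> j)) < 2 * N"
      using degree_lagrange_poly[of ?S "\<pi> j" x] \<pi>(1)[OF j] by simp
    have "a (\<pi> j) = (\<Sum>k\<in>?S. b k * poly (1 * ?l (\<pi> j)) (y k))"
      using sol[unfolded prony_solution_iff_quadrature, rule_format, OF d]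
        sol'[unfolded prony_solution_iff_quadrature, rule_format, OF d] eval[OF \<pi>(1)[OF j], of 1]
      by simp
    also have "\<dots> = (\<Sum>k\<in>?S. if j = k then b k else 0)"
    proof (intro sum.cong refl)
      fix k assume k: "k \<in> ?S"
      have "poly (?l (\<pi> j)) (y k) = of_bool (\<pi> j = \<pi> k)"
        using poly_lagrange_poly[OF _ inj \<pi>(1)[OF j] \<pi>(1)[OF k]] \<pi>(2)[OF k] by simp
      also have "\<pi> j = \<pi> k \<longleftrightarrow> j = k" using permutes_inj[OF perm] by (simp add: inj_eq)
      finally show "b k * poly (1 * ?l (\<pi> j)) (y k) = (if j = k then b k else 0)" by simp
    qed
    finally show ?thesis using j by simp
  qed
  with perm \<pi>(2) show ?thesis by auto
qed

section \<open>Constants governed by the nodes alone\<close>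

text \<open>
  All estimates below use one constant \<open>D\<close>. Its definition mentions no amplitudes, and this is
  why the final constant depends on the nodes only. The three coefficient sums bound
  the change of the moment functional on the test polynomials; the last two
  clauses say that near a node the Lagrange and Hermite polynomials deviate from their nodal values to first
  and second order.
\<close>

definition node_constant :: "nat \<Rightarrow> (nat \<Rightarrow> real) \<Rightarrow> real \<Rightarrow> bool" where
  "node_constant N x D \<longleftrightarrow> D \<ge> 1 \<and>
    (\<forall>i\<in>{1..N}. 1 \<le> D * \<bar>node_weight {1..N} x i\<bar> \<and>
      (\<Sum>k<2 * N. \<bar>coeff (node_poly {1..N} x * lagrange_poly {1..N} x i) k\<bar>) \<le> D \<and>
      (\<Sum>k<2 * N. \<bar>coeff (hermite_poly {1..N} x i) k\<bar>) \<le> D \<and>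
      (\<forall>j\<in>{1..N}.
        (\<Sum>k<2 * N. \<bar>coeff (lagrange_poly {1..N} x i * lagrange_poly {1..N} x j) k\<bar>) \<le> D \<and>
        (\<forall>t. \<bar>t - x j\<bar> \<le> 1 \<longrightarrow>
          \<bar>poly (lagrange_poly {1..N} x i) t - of_bool (i = j)\<bar> \<le> D * \<bar>t - x j\<bar>) \<and>
        (\<forall>t. \<bar>t - x j\<bar> \<le> 1 \<longrightarrow>
          \<bar>poly (hermite_poly {1..N} x i) t - of_bool (i = j)\<bar> \<le> D * \<bar>t - x j\<bar>\<^sup>2)))"

lemma node_constant_exists:
  assumes inj: "inj_on x {1..N}"
  shows "\<exists>D. node_constant N x D"
proof -
  let ?S = "{1..N}"
  have weight: "\<forall>\<^sub>F D in at_top. 1 \<le> D * \<bar>node_weight ?S x i\<bar>" if "i \<in> ?S" for i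
    using eventually_ge_at_top[of "1 / \<bar>node_weight ?S x i\<bar>"]
    by eventually_elim (use node_weight_nonzero[OF _ inj that] in \<open>simp add: field_simps\<close>)
  have lagrange: "\<forall>\<^sub>F D in at_top. \<forall>t. \<bar>t - x j\<bar> \<le> 1 \<longrightarrow>
      \<bar>poly (lagrange_poly ?S x i) t - of_bool (i = j)\<bar> \<le> D * \<bar>t - x j\<bar>"
    if "i \<in> ?S" "j \<in> ?S" for i j
  proof -
    have "[:- x j, 1:] ^ 1 dvd lagrange_poly ?S x i - [:of_bool (i = j):]"
      using poly_lagrange_poly[OF _ inj that] by (simp flip: poly_eq_0_iff_dvd)
    from eventually_power_bound_near_root[OF this] show ?thesis by simp
  qed
  have hermite: "\<forall>\<^sub>F D in at_top. \<forall>t. \<bar>t - x j\<bar> \<le> 1 \<longrightarrow>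
      \<bar>poly (hermite_poly ?S x i) t - of_bool (i = j)\<bar> \<le> D * \<bar>t - x j\<bar>\<^sup>2"
    if "i \<in> ?S" "j \<in> ?S" for i j
    using eventually_power_bound_near_root[OF square_dvd_hermite_poly[OF _ inj that]] by simp
  have "\<forall>\<^sub>F D in at_top. node_constant N x D"
    unfolding node_constant_def
    by (intro eventually_conj eventually_ball_finite ballI eventually_ge_at_top
        weight lagrange hermite) auto
  then show ?thesis by (rule eventually_happens'[rotated]) simp
qed

section \<open>The perturbed node polynomial\<close>

text \<open>
  Orthogonality against the Lagrange basis is the linear system with matrix
  \<open>L(\<ell>\<^sub>i \<ell>\<^sub>j)\<close> and right-hand side \<open>- L(P \<ell>\<^sub>i)\<close>. In the unperturbed case these are the diagonal matrix
  of amplitudes and zero; \<open>E\<close> is the deviation of the matrix from that diagonal.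
\<close>

lemma orthogonal_poly_exists:
  assumes D: "node_constant N x D" and inj: "inj_on x {1..N}"
    and \<alpha>: "\<alpha> > 0" "\<And>i. i \<in> {1..N} \<Longrightarrow> \<alpha> \<le> \<bar>a i\<bar>"
    and \<mu>: "\<And>k. k < 2 * N \<Longrightarrow> \<bar>moment N a x k - \<mu> k\<bar> \<le> \<epsilon>"
    and \<epsilon>: "\<epsilon> \<ge> 0" "2 * real N * (D * \<epsilon>) \<le> \<alpha>"
  shows "\<exists>c. (\<forall>i\<in>{1..N}. \<bar>a i * c i\<bar> \<le> 2 * (D * \<epsilon>)) \<and>
    (\<forall>q. degree q < N \<longrightarrow> moment_functional N \<mu>
      ((node_poly {1..N} x + (\<Sum>j=1..N. smult (c j) (lagrange_poly {1..N} x j))) * q) = 0)"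
proof -
  let ?S = "{1..N}" and ?P = "node_poly {1..N} x" and ?l = "lagrange_poly {1..N} x"
  let ?L = "moment_functional N \<mu>" and ?M = "moment_functional N (moment N a x)"
  have exact: "?M p = (\<Sum>j\<in>?S. a j * poly p (x j))" if "degree p < 2 * N" for p
    using prony_solution_moments that unfolding prony_solution_iff_quadrature by blast
  define E where "E i j = ?L (?l i * ?l j) - of_bool (i = j) * a i" for i j
  have E: "\<bar>E i j\<bar> \<le> D * \<epsilon>" if "i \<in> ?S" "j \<in> ?S" for i j
  proof -
    have "degree (?l i * ?l j) < 2 * N"
      using degree_mult_le[of "?l i" "?l j"] degree_lagrange_poly[of ?S i x]
        degree_lagrange_poly[of ?S j x] that by simp
    then have "?M (?l i * ?l j) = (\<Sum>k\<in>?S. if i = k then of_bool (i = j) * a i else 0)"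
      unfolding exact[OF \<open>degree (?l i * ?l j) < 2 * N\<close>] using that inj
      by (intro sum.cong) (auto simp: poly_lagrange_poly)
    then have "?M (?l i * ?l j) = of_bool (i = j) * a i" using that by simp
    moreover have "(\<Sum>k<2 * N. \<bar>coeff (?l i * ?l j) k\<bar>) \<le> D"
      using D that unfolding node_constant_def by blast
    from moment_functional_perturbation[OF _ this \<epsilon>(1), of "moment N a x" \<mu>] \<mu>
    have "\<bar>?L (?l i * ?l j) - ?M (?l i * ?l j)\<bar> \<le> D * \<epsilon>" by blast
    ultimately show ?thesis by (simp only: E_def)
  qed
  have e: "\<bar>- ?L (?P * ?l i)\<bar> \<le> D * \<epsilon>" if "i \<in> ?S" for i
  proof -
    have "degree (?P * ?l i) < 2 * N"
      using degree_mult_le[of ?P "?l i"] degree_lagrange_poly[of ?S i x] that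
      by (simp add: degree_node_poly)
    moreover have "poly ?P (x j) = 0" if "j \<in> ?S" for j using that by (auto simp: poly_node_poly)
    ultimately have "?M (?P * ?l i) = 0" by (simp add: exact)
    moreover have "(\<Sum>k<2 * N. \<bar>coeff (?P * ?l i) k\<bar>) \<le> D"
      using D that unfolding node_constant_def by blast
    from moment_functional_perturbation[OF _ this \<epsilon>(1), of "moment N a x" \<mu>] \<mu>
    have "\<bar>?L (?P * ?l i) - ?M (?P * ?l i)\<bar> \<le> D * \<epsilon>" by blast
    ultimately show ?thesis by simp
  qed
  have small: "2 * real (card ?S) * (D * \<epsilon>) \<le> \<alpha>" using \<epsilon>(2) by simp
  obtain c where c: "\<And>i. i \<in> ?S \<Longrightarrow> a i * c i + (\<Sum>j\<in>?S. E i j * c j) = - ?L (?P * ?l i)"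
    using nearly_diagonal_system_solvable[of ?S \<alpha> a E "D * \<epsilon>" "\<lambda>i. - ?L (?P * ?l i)",
        OF _ \<alpha> E small] by blast
  let ?Q = "?P + (\<Sum>j\<in>?S. smult (c j) (?l j))"
  have orth: "?L (?Q * ?l i) = 0" if i: "i \<in> ?S" for i
  proof -
    have "?L (?Q * ?l i) = ?L (?P * ?l i) + (\<Sum>j\<in>?S. c j * ?L (?l i * ?l j))"
      by (simp add: distrib_right sum_distrib_right moment_functional_add moment_functional_sum
          moment_functional_smult) (simp only: mult.commute)
    also have "(\<Sum>j\<in>?S. c j * ?L (?l i * ?l j))
        = (\<Sum>j\<in>?S. (if i = j then a i * c i else 0) + E i j * c j)"
      by (intro sum.cong) (auto simp: E_def algebra_simps)
    also have "\<dots> = a i * c i + (\<Sum>j\<in>?S. E i j * c j)" using i by (simp add: sum.distrib)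
    finally show ?thesis using c[OF i] by simp
  qed
  have "?L (?Q * q) = 0" if "degree q < N" for q
  proof -
    have "?L (?Q * q) = ?L (?Q * (\<Sum>i\<in>?S. smult (poly q (x i)) (?l i)))"
      using lagrange_interpolation[OF _ inj, of q] that by simp
    also have "\<dots> = (\<Sum>i\<in>?S. poly q (x i) * ?L (?Q * ?l i))"
      by (simp only: sum_distrib_left moment_functional_sum mult_smult_right moment_functional_smult)
    also have "\<dots> = 0" using orth by simp
    finally show ?thesis .
  qed
  moreover have "\<bar>a i * c i\<bar> \<le> 2 * (D * \<epsilon>)" if "i \<in> ?S" for i
    using nearly_diagonal_system_bound[of ?S \<alpha> a E "D * \<epsilon>" c, OF _ \<alpha> E small c e that] by simp
  ultimately show ?thesis by blast
qed

text \<open>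
  With \<open>W = P'(x\<^sub>i)\<close> one has \<open>P(t) = (t - x\<^sub>i) W \<ell>\<^sub>i(t)\<close>, hence
  \<open>Q(t) = \<ell>\<^sub>i(t) ((t - x\<^sub>i) W + c\<^sub>i) + R(t)\<close>, where \<open>R\<close> collects the terms with \<open>j \<noteq> i\<close>. At distance
  \<open>r\<close> from \<open>x\<^sub>i\<close> the summand \<open>c\<^sub>i\<close> is at most half as large as \<open>r W\<close>, the factor \<open>\<ell>\<^sub>i\<close> is at least \<open>1/2\<close>,
  and \<open>R\<close>, which is small because \<open>\<ell>\<^sub>j(x\<^sub>i) = 0\<close>, is below a quarter of \<open>r W\<close>. Thus \<open>Q\<close> has opposite
  signs at the two ends \<open>x\<^sub>i - r\<close> and \<open>x\<^sub>i + r\<close>.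
\<close>

lemma perturbed_node_poly_root:
  fixes c :: "nat \<Rightarrow> real"
  assumes D: "node_constant N x D" and inj: "inj_on x {1..N}" and i: "i \<in> {1..N}"
    and r: "r > 0" "D * r \<le> 1 / 2"
    and ci: "2 * D * \<bar>c i\<bar> \<le> r"
    and c: "\<And>j. j \<in> {1..N} \<Longrightarrow> \<bar>c j\<bar> \<le> \<gamma>" and \<gamma>: "4 * real N * D\<^sup>2 * \<gamma> < 1"
  shows "\<exists>t. \<bar>t - x i\<bar> \<le> r \<and>
    poly (node_poly {1..N} x + (\<Sum>j=1..N. smult (c j) (lagrange_poly {1..N} x j))) t = 0"
proof -
  let ?S = "{1..N}" and ?l = "lagrange_poly {1..N} x"
  let ?Q = "node_poly {1..N} x + (\<Sum>j=1..N. smult (c j) (?l j))"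
  define W where "W = node_weight ?S x i"
  have D1: "D \<ge> 1" and W: "1 \<le> D * \<bar>W\<bar>" using D i by (auto simp: node_constant_def W_def)
  have r1: "r \<le> 1" using r mult_right_mono[OF D1, of r] by linarith
  have W0: "\<bar>W\<bar> > 0" using W by auto
  have \<gamma>0: "\<gamma> \<ge> 0" using c[OF i] by linarith
  have sign: "s * W * poly ?Q (x i + s * r) > 0" if s: "s = 1 \<or> s = - 1" for s
  proof -
    define t where "t = x i + s * r"
    have tr: "\<bar>t - x i\<bar> = r" "\<bar>s\<bar> = 1" using s r by (auto simp: t_def)
    define R where "R = (\<Sum>j\<in>?S - {i}. c j * poly (?l j) t)"
    define u where "u = poly (?l i) t"
    have Q: "poly ?Q t = u * (s * r * W + c i) + R"
      using i node_poly_eq_lagrange[OF _ inj i, of t]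
      by (simp add: poly_sum sum.remove R_def u_def t_def W_def algebra_simps)
    have t1: "\<bar>t - x i\<bar> \<le> 1" using tr r1 by simp
    have "\<bar>poly (?l i) t - of_bool (i = i)\<bar> \<le> D * \<bar>t - x i\<bar>"
      using D i t1 unfolding node_constant_def by blast
    then have "\<bar>u - 1\<bar> \<le> D * r" using tr by (simp add: u_def)
    then have u: "u \<ge> 1 / 2" using r by linarith
    have "\<bar>R\<bar> \<le> (\<Sum>j\<in>?S - {i}. \<gamma> * (D * r))"
      unfolding R_def
    proof (intro order.trans[OF sum_abs] sum_mono)
      fix j assume j: "j \<in> ?S - {i}"
      have "\<bar>poly (?l j) t - of_bool (j = i)\<bar> \<le> D * \<bar>t - x i\<bar>"
        using D i j t1 unfolding node_constant_def by blast
      then have "\<bar>poly (?l j) t\<bar> \<le> D * r" using j tr by simp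
      then show "\<bar>c j * poly (?l j) t\<bar> \<le> \<gamma> * (D * r)"
        using c[of j] j \<gamma>0 by (auto simp: abs_mult intro!: mult_mono)
    qed
    also have "\<dots> \<le> (\<Sum>j\<in>?S. \<gamma> * (D * r))"
      using \<gamma>0 D1 r by (intro sum_mono2) auto
    also have "\<dots> = real N * D * \<gamma> * r" by simp
    finally have "D * \<bar>R\<bar> \<le> D * (real N * D * \<gamma> * r)" using D1 by (intro mult_left_mono) auto
    also have "\<dots> = (4 * real N * D\<^sup>2 * \<gamma>) * r / 4" by (simp add: power2_eq_square)
    also have "\<dots> < r / 4" using \<gamma> r by simp
    also have "\<dots> \<le> r / 4 * (D * \<bar>W\<bar>)" using W r by simp
    finally have "D * \<bar>R\<bar> < D * (r * \<bar>W\<bar> / 4)" by (simp add: algebra_simps)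
    then have R: "\<bar>R\<bar> < r * \<bar>W\<bar> / 4" using D1 by simp
    have "2 * D * \<bar>c i\<bar> \<le> r * (D * \<bar>W\<bar>)" using ci mult_left_mono[OF W, of r] r by linarith
    then have "D * (2 * \<bar>c i\<bar>) \<le> D * (r * \<bar>W\<bar>)" by (simp add: algebra_simps)
    then have ci': "2 * \<bar>c i\<bar> \<le> r * \<bar>W\<bar>" using D1 by simp
    have "\<bar>s * W * c i\<bar> \<le> \<bar>W\<bar> * (r * \<bar>W\<bar> / 2)"
      using mult_left_mono[OF ci', of "\<bar>W\<bar>"] tr by (simp add: abs_mult)
    then have main: "r * W\<^sup>2 / 2 \<le> r * W\<^sup>2 + s * W * c i"
      by (simp add: power2_eq_square abs_mult_self_eq abs_le_iff algebra_simps)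
    have "\<bar>s * W * R\<bar> < \<bar>W\<bar> * (r * \<bar>W\<bar> / 4)"
      using R W0 tr by (simp add: abs_mult)
    then have rest: "\<bar>s * W * R\<bar> < r * W\<^sup>2 / 4"
      by (simp add: power2_eq_square algebra_simps)
    have "r * W\<^sup>2 / 4 \<le> u * (r * W\<^sup>2 / 2)"
      using mult_right_mono[OF u, of "r * W\<^sup>2 / 2"] r by simp
    also have "\<dots> \<le> u * (r * W\<^sup>2 + s * W * c i)" using main u by (intro mult_left_mono) auto
    finally have "0 < u * (r * W\<^sup>2 + s * W * c i) + s * W * R" using rest by linarith
    also have "\<dots> = s * W * poly ?Q t"
      unfolding Q using s by (auto simp: power2_eq_square algebra_simps)
    finally show ?thesis unfolding t_def .
  qed
  define Qp where "Qp = poly ?Q (x i + r)"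
  define Qm where "Qm = poly ?Q (x i - r)"
  have "0 < W * Qp" "0 < - (W * Qm)"
    using sign[of 1] sign[of "-1"] by (simp_all add: Qp_def Qm_def)
  then have "0 < (W * Qp) * - (W * Qm)" by (rule mult_pos_pos)
  then have "W\<^sup>2 * (Qm * Qp) < 0" by (simp add: power2_eq_square algebra_simps)
  then have "Qm * Qp < 0" by (simp add: mult_less_0_iff)
  then have "poly ?Q (x i - r) * poly ?Q (x i + r) < 0" by (simp only: Qp_def Qm_def)
  then obtain t where "x i - r < t" "t < x i + r" "poly ?Q t = 0"
    using poly_IVT[of "x i - r" "x i + r" ?Q] r by auto
  then show ?thesis by (intro exI[of _ t]) auto
qed

section \<open>The perturbed amplitudes\<close>

text \<open>
  Applied to \<open>h\<^sub>i\<close>, the exact functional gives \<open>a\<^sub>i\<close> and the perturbed one gives \<open>b\<^sub>i\<close> up to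
  \<open>\<delta> \<Sum> \<bar>b\<^sub>j\<bar>\<close>, where \<open>\<delta> = D \<rho>\<^sup>2\<close> is the second-order deviation of the Hermite polynomials. The unknown sum
  \<open>B = \<Sum> \<bar>b\<^sub>j\<bar>\<close> is eliminated by adding up these estimates over \<open>i\<close>: as \<open>N \<delta> \<le> 1/2\<close>, half of \<open>B\<close> is
  absorbed on the left.
\<close>

lemma amplitude_perturbation:
  assumes D: "node_constant N x D" and inj: "inj_on x {1..N}"
    and \<mu>: "\<And>k. k < 2 * N \<Longrightarrow> \<bar>moment N a x k - \<mu> k\<bar> \<le> \<epsilon>" and \<epsilon>: "\<epsilon> \<ge> 0"
    and sol: "prony_solution N \<mu> b y"
    and y: "\<And>j. j \<in> {1..N} \<Longrightarrow> \<bar>y j - x j\<bar> \<le> \<rho>" and \<rho>: "\<rho> \<le> 1" "2 * real N * (D * \<rho>\<^sup>2) \<le> 1"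
    and i: "i \<in> {1..N}"
  shows "\<bar>b i - a i\<bar> \<le> D * \<epsilon> + D * \<rho>\<^sup>2 * (2 * ((\<Sum>j=1..N. \<bar>a j\<bar>) + real N * (D * \<epsilon>)))"
proof -
  let ?S = "{1..N}" and ?h = "hermite_poly {1..N} x"
  define A where "A = (\<Sum>j\<in>?S. \<bar>a j\<bar>)"
  define B where "B = (\<Sum>j\<in>?S. \<bar>b j\<bar>)"
  define \<delta> where "\<delta> = D * \<rho>\<^sup>2"
  have D1: "D \<ge> 1" using D by (simp add: node_constant_def)
  have near: "\<bar>poly (?h k) (y j) - of_bool (k = j)\<bar> \<le> \<delta>" if "k \<in> ?S" "j \<in> ?S" for k j
  proof -
    have "\<bar>poly (?h k) (y j) - of_bool (k = j)\<bar> \<le> D * \<bar>y j - x j\<bar>\<^sup>2"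
      using D that y[OF that(2)] \<rho>(1) unfolding node_constant_def by force
    also have "\<dots> \<le> \<delta>" unfolding \<delta>_def using y[OF that(2)] D1 by (intro mult_left_mono power_mono) auto
    finally show ?thesis .
  qed
  have crude: "\<bar>b k - a k\<bar> \<le> D * \<epsilon> + \<delta> * B" if k: "k \<in> ?S" for k
  proof -
    have deg: "degree (?h k) < 2 * N" using degree_hermite_poly[of ?S k x] k by simp
    have hx: "poly (?h k) (x j) = of_bool (k = j)" if "j \<in> ?S" for j
    proof -
      have "[:- x j, 1:] dvd ?h k - [:of_bool (k = j):]"
        using square_dvd_hermite_poly[OF _ inj k that] by (metis dvd_trans dvd_triv_left power2_eq_square finite_atLeastAtMost)
      then show ?thesis by (simp flip: poly_eq_0_iff_dvd)
    qed
    have "moment_functional N (moment N a x) (?h k) = (\<Sum>j\<in>?S. a j * poly (?h k) (x j))"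
      using prony_solution_moments deg unfolding prony_solution_iff_quadrature by blast
    also have "\<dots> = (\<Sum>j\<in>?S. if k = j then a j else 0)" using hx by (intro sum.cong) auto
    finally have m: "moment_functional N (moment N a x) (?h k) = a k" using k by simp
    have "moment_functional N \<mu> (?h k) = (\<Sum>j\<in>?S. b j * poly (?h k) (y j))"
      using sol deg unfolding prony_solution_iff_quadrature by blast
    also have "\<dots> = (\<Sum>j\<in>?S. (if k = j then b j else 0)
        + b j * (poly (?h k) (y j) - of_bool (k = j)))"
      by (intro sum.cong) (auto simp: algebra_simps)
    finally have m': "moment_functional N \<mu> (?h k)
        = b k + (\<Sum>j\<in>?S. b j * (poly (?h k) (y j) - of_bool (k = j)))"
      using k by (simp add: sum.distrib)
    have "\<bar>\<Sum>j\<in>?S. b j * (poly (?h k) (y j) - of_bool (k = j))\<bar> \<le> (\<Sum>j\<in>?S. \<bar>b j\<bar> * \<delta>)"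
      by (rule order.trans[OF sum_abs], rule sum_mono, unfold abs_mult,
          rule mult_left_mono[OF near[OF k]]) auto
    also have "\<dots> = \<delta> * B" by (simp add: B_def mult.commute flip: sum_distrib_left)
    finally have err: "\<bar>\<Sum>j\<in>?S. b j * (poly (?h k) (y j) - of_bool (k = j))\<bar> \<le> \<delta> * B" .
    have "(\<Sum>l<2 * N. \<bar>coeff (?h k) l\<bar>) \<le> D"
      using D k unfolding node_constant_def by blast
    from moment_functional_perturbation[OF _ this \<epsilon>, of "moment N a x" \<mu>] \<mu>
    have "\<bar>moment_functional N \<mu> (?h k) - moment_functional N (moment N a x) (?h k)\<bar> \<le> D * \<epsilon>" by blast
    then show ?thesis using err m m' by linarith
  qed
  have "B \<le> (\<Sum>j\<in>?S. \<bar>a j\<bar> + (D * \<epsilon> + \<delta> * B))"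
    unfolding B_def by (intro sum_mono) (use crude in \<open>fastforce simp: B_def\<close>)
  also have "\<dots> = A + real N * (D * \<epsilon>) + real N * \<delta> * B"
    by (simp add: A_def sum.distrib algebra_simps)
  also have "real N * \<delta> * B \<le> 1 / 2 * B"
    using \<rho>(2) by (intro mult_right_mono) (auto simp: \<delta>_def B_def sum_nonneg)
  finally have "B \<le> 2 * (A + real N * (D * \<epsilon>))" by simp
  then have "\<delta> * B \<le> \<delta> * (2 * (A + real N * (D * \<epsilon>)))"
    using D1 by (intro mult_left_mono) (auto simp: \<delta>_def)
  with crude[OF i] show ?thesis by (simp add: A_def \<delta>_def)
qed

section \<open>Stability of the Prony system\<close>

text \<open>
  Put \<open>\<rho> = 4 D\<^sup>2 \<epsilon> / \<alpha>\<close>, an upper bound for all node errors. The first smallness condition on \<open>\<epsilon>\<close> says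
  \<open>2 N D \<rho> < 1\<close>; it makes the linear system nearly diagonal, keeps the root intervals
  inside the region where the Lagrange polynomials stay within \<open>1/2\<close> of their nodal values, and thereby
  separates the new nodes. The second one says that the quadratic contribution of the node errors to the
  amplitudes, which depends on all amplitudes, is at most \<open>\<epsilon>\<close>.
\<close>

lemma perturbed_prony_solution:
  assumes D: "node_constant N x D" and N: "N \<ge> 1" and inj: "inj_on x {1..N}"
    and \<alpha>: "\<alpha> > 0" "\<And>i. i \<in> {1..N} \<Longrightarrow> \<alpha> \<le> \<bar>a i\<bar>"
    and \<epsilon>: "\<epsilon> > 0"
    and \<epsilon>1: "8 * real N * D ^ 3 * \<epsilon> < \<alpha>"
    and \<epsilon>2: "16 * D ^ 5 * (2 * (\<Sum>j=1..N. \<bar>a j\<bar>) + \<alpha>) * \<epsilon> < \<alpha>\<^sup>2"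
    and \<mu>: "\<And>k. k < 2 * N \<Longrightarrow> \<bar>moment N a x k - \<mu> k\<bar> \<le> \<epsilon>"
  shows "\<exists>b y. prony_solution N \<mu> b y \<and> inj_on y {1..N} \<and>
    (\<forall>j\<in>{1..N}. \<bar>y j - x j\<bar> \<le> 4 * D\<^sup>2 * \<epsilon> * inverse \<bar>a j\<bar> \<and> \<bar>b j - a j\<bar> \<le> (D + 1) * \<epsilon>)"
proof -
  let ?S = "{1..N}" and ?l = "lagrange_poly {1..N} x"
  have D1: "D \<ge> 1" using D by (simp add: node_constant_def)
  have N1: "real N \<ge> 1" using N by simp
  define \<rho> where "\<rho> = 4 * D\<^sup>2 * \<epsilon> / \<alpha>"
  have "D ^ 2 \<ge> 1" "D ^ 3 \<ge> D" using D1 power_increasing[of 1 3 D] by (auto simp: one_le_power)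
  have ND: "2 * real N * (D * \<epsilon>) \<le> \<alpha>"
  proof -
    have "real N * D * \<epsilon> \<le> real N * D ^ 3 * \<epsilon>" "0 \<le> real N * D * \<epsilon>"
      using \<open>D ^ 3 \<ge> D\<close> \<epsilon> D1 by (auto intro!: mult_left_mono mult_right_mono)
    then show ?thesis using \<epsilon>1 by (simp add: algebra_simps)
  qed
  have NDr: "2 * real N * (D * \<rho>) < 1"
    using \<epsilon>1 \<alpha>(1) by (simp add: \<rho>_def field_simps power2_eq_square power3_eq_cube)
  have \<rho>0: "\<rho> > 0" using \<epsilon> \<alpha> D1 by (simp add: \<rho>_def)
  have Dr: "D * \<rho> < 1 / 2"
  proof -
    have "D * \<rho> \<le> real N * (D * \<rho>)" using N1 D1 \<rho>0 by simp
    then show ?thesis using NDr by linarith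
  qed
  have r1: "\<rho> \<le> 1 / 2" using Dr D1 \<rho>0 mult_right_mono[of 1 D \<rho>] by linarith
  obtain c where c: "\<And>i. i \<in> ?S \<Longrightarrow> \<bar>a i * c i\<bar> \<le> 2 * (D * \<epsilon>)"
    and orth: "\<And>q. degree q < N \<Longrightarrow>
      moment_functional N \<mu> ((node_poly ?S x + (\<Sum>j=1..N. smult (c j) (?l j))) * q) = 0"
    using orthogonal_poly_exists[where a = a and \<mu> = \<mu>, OF D inj \<alpha> \<mu> less_imp_le[OF \<epsilon>] ND]
    by metis
  define Q where "Q = node_poly ?S x + (\<Sum>j=1..N. smult (c j) (?l j))"
  have radius: "4 * D\<^sup>2 * \<epsilon> / \<bar>a i\<bar> \<le> \<rho>" if "i \<in> ?S" for i
    unfolding \<rho>_def using \<alpha>(1) \<alpha>(2)[OF that] \<epsilon> by (intro divide_left_mono) auto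
  have c_uniform: "\<bar>c i\<bar> \<le> 2 * D * \<epsilon> / \<alpha>" if "i \<in> ?S" for i
  proof -
    have "\<alpha> * \<bar>c i\<bar> \<le> \<bar>a i\<bar> * \<bar>c i\<bar>" using \<alpha>(2)[OF that] by (simp add: mult_right_mono)
    then show ?thesis using c[OF that] \<alpha>(1) by (simp add: abs_mult field_simps)
  qed
  have "\<exists>t. \<bar>t - x i\<bar> \<le> 4 * D\<^sup>2 * \<epsilon> / \<bar>a i\<bar> \<and> poly Q t = 0" if i: "i \<in> ?S" for i
  proof -
    have ai: "\<bar>a i\<bar> > 0" using \<alpha>(1) \<alpha>(2)[OF i] by linarith
    have "D * (4 * D\<^sup>2 * \<epsilon> / \<bar>a i\<bar>) \<le> D * \<rho>" using radius[OF i] D1 by (intro mult_left_mono) auto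
    then have *: "D * (4 * D\<^sup>2 * \<epsilon> / \<bar>a i\<bar>) \<le> 1 / 2" using Dr by linarith
    have "2 * D * \<bar>a i * c i\<bar> \<le> 2 * D * (2 * (D * \<epsilon>))"
      using c[OF i] D1 by (intro mult_left_mono) auto
    then have **: "2 * D * \<bar>c i\<bar> \<le> 4 * D\<^sup>2 * \<epsilon> / \<bar>a i\<bar>"
      using ai by (simp add: abs_mult field_simps power2_eq_square)
    have ***: "4 * real N * D\<^sup>2 * (2 * D * \<epsilon> / \<alpha>) < 1"
      using \<epsilon>1 \<alpha>(1) by (simp add: field_simps power2_eq_square power3_eq_cube)
    show ?thesis
      unfolding Q_def
    proof (rule perturbed_node_poly_root[where c = c and \<gamma> = "2 * D * \<epsilon> / \<alpha>", OF D inj i])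
      show "4 * D\<^sup>2 * \<epsilon> / \<bar>a i\<bar> > 0" using ai \<epsilon> D1 by simp
    qed (fact * ** *** c_uniform)+
  qed
  then obtain y where y: "\<And>i. i \<in> ?S \<Longrightarrow> \<bar>y i - x i\<bar> \<le> 4 * D\<^sup>2 * \<epsilon> / \<bar>a i\<bar>"
    and root: "\<And>i. i \<in> ?S \<Longrightarrow> poly Q (y i) = 0" by metis
  have y\<rho>: "\<bar>y i - x i\<bar> \<le> \<rho>" if "i \<in> ?S" for i using y[OF that] radius[OF that] by linarith
  have near: "\<bar>poly (?l i) (y j) - of_bool (i = j)\<bar> < 1 / 2" if "i \<in> ?S" "j \<in> ?S" for i j
  proof -
    have "\<bar>poly (?l i) (y j) - of_bool (i = j)\<bar> \<le> D * \<bar>y j - x j\<bar>"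
      using D that y\<rho>[OF that(2)] r1 unfolding node_constant_def by force
    also have "\<dots> \<le> D * \<rho>" using y\<rho>[OF that(2)] D1 by (intro mult_left_mono) auto
    finally show ?thesis using Dr by linarith
  qed
  \<comment> \<open>At a common value the \<open>i\<close>-th Lagrange polynomial would be within \<open>1/2\<close> of both \<open>1\<close> and \<open>0\<close>.\<close>
  have injy: "inj_on y ?S"
  proof (rule inj_onI, rule ccontr)
    fix i j assume ij: "i \<in> ?S" "j \<in> ?S" "y i = y j" "i \<noteq> j"
    then show False using near[of i i] near[of i j] by auto
  qed
  have "Q - node_poly ?S y = 0"
  proof (rule poly_zero_of_many_roots[OF injy])
    \<comment> \<open>Both polynomials are monic of degree \<open>N\<close>, so their difference has smaller degree.\<close>
    have "degree (\<Sum>j=1..N. smult (c j) (?l j)) \<le> N - 1"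
      using degree_lagrange_poly[of ?S _ x]
      by (intro degree_sum_le) (fastforce intro: order.trans[OF degree_smult_le])+
    then have "degree (\<Sum>j=1..N. smult (c j) (?l j)) < N" using N by linarith
    then have high: "coeff (Q - node_poly ?S y) k = 0" if "k \<ge> N" for k
      using that lead_coeff_node_poly[of ?S x] lead_coeff_node_poly[of ?S y]
      by (cases "k = N") (simp_all add: Q_def degree_node_poly coeff_eq_0)
    show "degree (Q - node_poly ?S y) < card ?S"
    proof (rule ccontr)
      assume "\<not> degree (Q - node_poly ?S y) < card ?S"
      then have large: "N \<le> degree (Q - node_poly ?S y)" by simp
      then have "Q - node_poly ?S y = 0" using high[OF large] by (simp only: leading_coeff_0_iff)
      then show False using large N by simp
    qed
    show "poly (Q - node_poly ?S y) (y i) = 0" if "i \<in> ?S" for i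
      using that root[OF that] by (auto simp: poly_node_poly)
  qed
  then have "Q = node_poly ?S y" by simp
  then obtain b where sol: "prony_solution N \<mu> b y"
    using prony_solution_of_orthogonal_node_poly[OF N injy] orth unfolding Q_def by metis
  have "\<bar>b i - a i\<bar> \<le> (D + 1) * \<epsilon>" if i: "i \<in> ?S" for i
  proof -
    define A where "A = (\<Sum>j=1..N. \<bar>a j\<bar>)"
    have A0: "A \<ge> 0" by (simp add: A_def sum_nonneg)
    have "2 * real N * (D * \<rho>\<^sup>2) = (2 * real N * (D * \<rho>)) * \<rho>" by (simp add: power2_eq_square)
    also have "\<dots> \<le> 1 * 1" using NDr r1 \<rho>0 D1 by (intro mult_mono) auto
    finally have "\<bar>b i - a i\<bar> \<le> D * \<epsilon> + D * \<rho>\<^sup>2 * (2 * (A + real N * (D * \<epsilon>)))"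
      unfolding A_def using amplitude_perturbation[OF D inj \<mu> _ sol y\<rho> _ _ i] \<epsilon> r1 by simp
    also have "D * \<rho>\<^sup>2 * (2 * (A + real N * (D * \<epsilon>))) \<le> D * \<rho>\<^sup>2 * (2 * A + \<alpha>)"
      using ND D1 by (intro mult_left_mono) auto
    also have "\<dots> = (16 * D ^ 5 * (2 * A + \<alpha>) * \<epsilon>) * \<epsilon> / \<alpha>\<^sup>2"
      by (simp add: \<rho>_def power_divide power_mult_distrib eval_nat_numeral)
    also have "\<dots> \<le> \<alpha>\<^sup>2 * \<epsilon> / \<alpha>\<^sup>2"
      using \<epsilon>2 \<epsilon> \<alpha>(1) by (intro divide_right_mono mult_right_mono) (auto simp: A_def)
    also have "\<dots> = \<epsilon>" using \<alpha>(1) by simp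
    finally show ?thesis by (simp add: algebra_simps)
  qed
  with sol injy y[unfolded divide_inverse] show ?thesis by blast
qed

lemma eventually_scaled_less_at_right_0:
  fixes c d :: real
  assumes "d > 0"
  shows "\<forall>\<^sub>F \<epsilon> in at_right 0. c * \<epsilon> < d"
proof -
  have "((\<lambda>\<epsilon>. c * \<epsilon>) \<longlongrightarrow> c * 0) (at_right 0)" by (intro tendsto_intros)
  then show ?thesis using assms by (auto intro: order_tendstoD)
qed

theorem theorem3:
  fixes N :: nat and x :: "nat \<Rightarrow> real"
  assumes "N \<ge> 1" and "inj_on x {1..N}"
  shows "\<exists>C\<^sub>1::real. \<forall>a :: nat \<Rightarrow> real. (\<forall>j\<in>{1..N}. a j \<noteq> 0) \<longrightarrow>
    (\<exists>\<epsilon>\<^sub>0>0. \<forall>\<epsilon>. 0 < \<epsilon> \<and> \<epsilon> < \<epsilon>\<^sub>0 \<longrightarrow>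
      (\<forall>\<mu> :: nat \<Rightarrow> real. (MAX k\<in>{..<2 * N}. \<bar>moment N a x k - \<mu> k\<bar>) < \<epsilon> \<longrightarrow>
        (\<exists>a' x'. prony_solution N \<mu> a' x' \<and>
          (\<forall>b y. prony_solution N \<mu> b y \<longrightarrow>
            (\<exists>\<pi>. \<pi> permutes {1..N} \<and> (\<forall>j\<in>{1..N}. b j = a' (\<pi> j) \<and> y j = x' (\<pi> j)))) \<and>
          (\<forall>j\<in>{1..N}. \<bar>x' j - x j\<bar> \<le> C\<^sub>1 * \<epsilon> * inverse \<bar>a j\<bar> \<and>
                       \<bar>a' j - a j\<bar> \<le> C\<^sub>1 * \<epsilon>))))"
proof -
  obtain D where D: "node_constant N x D" using node_constant_exists[OF assms(2)] by blast
  then have D1: "D \<ge> 1" by (simp add: node_constant_def)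
  then have "D * 1 \<le> D * D" by (intro mult_left_mono) auto
  then have DD: "D + 1 \<le> 4 * D\<^sup>2" using D1 unfolding power2_eq_square by linarith
  show ?thesis
  proof (rule exI[of _ "4 * D\<^sup>2"], intro allI impI)
    fix a :: "nat \<Rightarrow> real" assume nz: "\<forall>j\<in>{1..N}. a j \<noteq> 0"
    define \<alpha> where "\<alpha> = Min ((\<lambda>j. \<bar>a j\<bar>) ` {1..N})"
    have \<alpha>: "\<alpha> > 0" "\<And>j. j \<in> {1..N} \<Longrightarrow> \<alpha> \<le> \<bar>a j\<bar>"
      using nz assms(1) by (auto simp: \<alpha>_def)
    have "\<forall>\<^sub>F \<epsilon> in at_right 0. 8 * real N * D ^ 3 * \<epsilon> < \<alpha> \<and>
        16 * D ^ 5 * (2 * (\<Sum>j=1..N. \<bar>a j\<bar>) + \<alpha>) * \<epsilon> < \<alpha>\<^sup>2 \<and> (D + 1) * \<epsilon> < \<alpha>"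
      using \<alpha>(1) by (intro eventually_conj eventually_scaled_less_at_right_0) auto
    then obtain \<epsilon>0 where \<epsilon>0: "\<epsilon>0 > 0" and small: "\<And>\<epsilon>. 0 < \<epsilon> \<Longrightarrow> \<epsilon> < \<epsilon>0 \<Longrightarrow>
        8 * real N * D ^ 3 * \<epsilon> < \<alpha> \<and>
        16 * D ^ 5 * (2 * (\<Sum>j=1..N. \<bar>a j\<bar>) + \<alpha>) * \<epsilon> < \<alpha>\<^sup>2 \<and> (D + 1) * \<epsilon> < \<alpha>"
      unfolding eventually_at_right_field by blast
    show "\<exists>\<epsilon>\<^sub>0>0. \<forall>\<epsilon>. 0 < \<epsilon> \<and> \<epsilon> < \<epsilon>\<^sub>0 \<longrightarrow>
      (\<forall>\<mu> :: nat \<Rightarrow> real. (MAX k\<in>{..<2 * N}. \<bar>moment N a x k - \<mu> k\<bar>) < \<epsilon> \<longrightarrow>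
        (\<exists>a' x'. prony_solution N \<mu> a' x' \<and>
          (\<forall>b y. prony_solution N \<mu> b y \<longrightarrow>
            (\<exists>\<pi>. \<pi> permutes {1..N} \<and> (\<forall>j\<in>{1..N}. b j = a' (\<pi> j) \<and> y j = x' (\<pi> j)))) \<and>
          (\<forall>j\<in>{1..N}. \<bar>x' j - x j\<bar> \<le> 4 * D\<^sup>2 * \<epsilon> * inverse \<bar>a j\<bar> \<and>
                       \<bar>a' j - a j\<bar> \<le> 4 * D\<^sup>2 * \<epsilon>)))"
    proof (intro exI[of _ \<epsilon>0] conjI allI impI \<epsilon>0)
      fix \<epsilon> \<mu>
      assume \<epsilon>: "0 < \<epsilon> \<and> \<epsilon> < \<epsilon>0"
        and max: "(MAX k\<in>{..<2 * N}. \<bar>moment N a x k - \<mu> k\<bar>) < \<epsilon>"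
      have "{..<2 * N} \<noteq> {}" using assms(1) by (auto simp: lessThan_empty_iff)
      then have \<mu>: "\<bar>moment N a x k - \<mu> k\<bar> \<le> \<epsilon>" if "k < 2 * N" for k
        using max that by (subst (asm) Max_less_iff) (auto simp: less_imp_le)
      obtain a' x' where sol: "prony_solution N \<mu> a' x'" and inj: "inj_on x' {1..N}"
        and near: "\<And>j. j \<in> {1..N} \<Longrightarrow> \<bar>x' j - x j\<bar> \<le> 4 * D\<^sup>2 * \<epsilon> * inverse \<bar>a j\<bar>"
          "\<And>j. j \<in> {1..N} \<Longrightarrow> \<bar>a' j - a j\<bar> \<le> (D + 1) * \<epsilon>"
        using perturbed_prony_solution[where a = a and \<mu> = \<mu>, OF D assms \<alpha> _ _ _ \<mu>] small[of \<epsilon>] \<epsilon> by metis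
      \<comment> \<open>The new amplitudes stay away from zero, as uniqueness requires.\<close>
      have "a' j \<noteq> 0" if "j \<in> {1..N}" for j
        using near(2)[OF that] \<alpha>(2)[OF that] small[of \<epsilon>] \<epsilon> by auto
      note unique = prony_solution_unique[OF sol inj this]
      have "(D + 1) * \<epsilon> \<le> 4 * D\<^sup>2 * \<epsilon>" using DD \<epsilon> by (intro mult_right_mono) auto
      with near(2) have "\<bar>a' j - a j\<bar> \<le> 4 * D\<^sup>2 * \<epsilon>" if "j \<in> {1..N}" for j
        using that by fastforce
      with sol unique near(1) show "\<exists>a' x'. prony_solution N \<mu> a' x' \<and>
          (\<forall>b y. prony_solution N \<mu> b y \<longrightarrow>
            (\<exists>\<pi>. \<pi> permutes {1..N} \<and> (\<forall>j\<in>{1..N}. b j = a' (\<pi> j) \<and> y j = x' (\<pi> j)))) \<and>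
          (\<forall>j\<in>{1..N}. \<bar>x' j - x j\<bar> \<le> 4 * D\<^sup>2 * \<epsilon> * inverse \<bar>a j\<bar> \<and>
                       \<bar>a' j - a j\<bar> \<le> 4 * D\<^sup>2 * \<epsilon>)"
        by blast
    qed
  qed
qed

end
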